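(* Let $1\le r<n$ and let $A\in\mathbb{R}^{n\times n}$ have the Schur form $$A=\begin{bmatrix}U_1&U_2\end{bmatrix}\begin{bmatrix}T_{1,1}&T_{1,2}\\0&T_{2,2}\end{bmatrix}\begin{bmatrix}U_1&U_2\end{bmatrix}^*,$$ where $\begin{bmatrix}U_1&U_2\end{bmatrix}$ is unitary with $U_1\in\mathbb{C}^{n\times r}$, $U_2\in\mathbb{C}^{n\times(n-r)}$, and $T_{1,1}\in\mathbb{C}^{r\times r}$, $T_{2,2}\in\mathbb{C}^{(n-r)\times(n-r)}$ are upper triangular. Let $$\mathsf{gap}=\min\{\mathsf{sep}_2(T_{1,1},T_{2,2}),\ \mathsf{sep}_{(2,\infty),U_2}(T_{1,1},U_2T_{2,2}U_2^* )\}$$ and assume $\mathsf{gap}>0$. Let $E\in\mathbb{R}^{n\times n}$ (not necessarily symmetric) and $\widehat A=A+E$. If $\|E\|_2\le\frac{\mathsf{gap}}{10}$ and $\|T_{1,2}\|_2\le\frac{\mathsf{gap}}{10}$, then there exists a matrix $\widehat Y\in\mathbb{C}^{(n-r)\times r}$ such that the range of $$\widehat U_1=(U_1+U_2\widehat Y)(I+\widehat Y^*\widehat Y)^{-1/2}$$ is an invariant subspace of $\widehat A$, and $$\min\{\|\widehat U_1Q-U_1\|_{2,\infty}:Q\in\mathbf{O}^r\}\le 8\|U_1\|_{2,\infty}\left(\frac{\|E\|_2}{\mathsf{sep}_2(T_{1,1},T_{2,2})}\right)^2+2\,\frac{\|U_2U_2^*EU_1\|_{2,\infty}}{\mathsf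{gap}}+4\,\frac{\|U_2U_2^*EU_2U_2^*\|_{2,\infty}\,\|E_{2,1}\|_2}{\mathsf{gap}\cdot\mathsf{sep}_2(T_{1,1},T_{2,2})}.$$
   Context: $\mathbf{O}^r$ is the set of $r\times r$ orthogonal matrices. $\|\cdot\|_2$ is the spectral norm, and $\|B\|_{2,\infty}=\max_i\|B_{i,:}\|_2$ is the maximum Euclidean norm of the rows of $B$. $E_{2,1}:=U_2^*EU_1$. For $B\in\mathbb{C}^{\ell\times\ell}$, $C\in\mathbb{C}^{m\times m}$ and a norm $\|\cdot\|_*$ on $\mathbb{C}^{m\times\ell}$, $\mathsf{sep}_*(B,C)=\inf\{\|ZB-CZ\|_*: Z\in\mathbb{C}^{m\times\ell},\ \|Z\|_*=1\}$. For a matrix $W$ with $m$ rows and orthonormal columns, $\mathsf{sep}_{*,W}(B,C)=\inf\{\|ZB-CZ\|_*: Z\in\mathbb{C}^{m\times\ell},\ \text{every column of } Z \text{ lies in } \mathrm{ran}\,W,\ \|Z\|_*=1\}$. The subscripts $2$ and $(2,\infty)$ refer to the norms $\|\cdot\|_2$ and $\|\cdot\|_{2,\infty}$. *)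

theory Defs
  imports "HOL-Analysis.Analysis"
begin

text \<open>
  As usual in HOL-Analysis, an m-by-l matrix has type \<open>'a ^ 'l ^ 'm\<close> (rows indexed by \<open>'m\<close>).
  Sizes are cardinalities of index types, so all sizes are at least 1. A real matrix \<open>M\<close> is
  viewed as a complex one through \<open>map_matrix complex_of_real M\<close>.
\<close>

definition conj_transpose :: "complex ^ 'l ^ 'm \<Rightarrow> complex ^ 'm ^ 'l" where
  "conj_transpose B = (\<chi> i j. cnj (B $ j $ i))"

text \<open>
  Row and column indices of a square matrix may come from different types of the same size (here
  \<open>'n\<close> for the rows of \<open>[U1 U2]\<close> and \<open>'r + 's\<close> for its columns). The two equations
  together force the two index types to have the same cardinality.
\<close>

definition unitary_matrix :: "complex ^ 'l ^ 'm \<Rightarrow> bool" where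
  "unitary_matrix U \<longleftrightarrow> conj_transpose U ** U = mat 1 \<and> U ** conj_transpose U = mat 1"

definition upper_triangular :: "complex ^ ('k :: {finite, linorder}) ^ ('k :: {finite, linorder}) \<Rightarrow> bool" where
  "upper_triangular T \<longleftrightarrow> (\<forall>i j. j < i \<longrightarrow> T $ i $ j = 0)"

definition block_columns :: "'a ^ 'r ^ 'n \<Rightarrow> 'a ^ 's ^ 'n \<Rightarrow> 'a ^ ('r + 's) ^ 'n" where
  "block_columns B C = (\<chi> i j. case j of Inl a \<Rightarrow> B $ i $ a | Inr b \<Rightarrow> C $ i $ b)"

definition block_rows :: "'a ^ 'n ^ 'r \<Rightarrow> 'a ^ 'n ^ 's \<Rightarrow> 'a ^ 'n ^ ('r + 's)" where
  "block_rows B C = (\<chi> i. case i of Inl a \<Rightarrow> B $ a | Inr b \<Rightarrow> C $ b)"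

definition schur_form ::
  "real ^ 'n ^ 'n \<Rightarrow>
   complex ^ ('r :: {finite, linorder}) ^ 'n \<Rightarrow>
   complex ^ ('s :: {finite, linorder}) ^ 'n \<Rightarrow>
   complex ^ ('r :: {finite, linorder}) ^ ('r :: {finite, linorder}) \<Rightarrow>
   complex ^ ('s :: {finite, linorder}) ^ ('r :: {finite, linorder}) \<Rightarrow>
   complex ^ ('s :: {finite, linorder}) ^ ('s :: {finite, linorder}) \<Rightarrow> bool" where
  "schur_form A U1 U2 T11 T12 T22 \<longleftrightarrow>
     unitary_matrix (block_columns U1 U2) \<and> upper_triangular T11 \<and> upper_triangular T22 \<and>
     map_matrix complex_of_real A =
       block_columns U1 U2 ** block_rows (block_columns T11 T12) (block_columns 0 T22) **
       conj_transpose (block_columns U1 U2)"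

definition spectral_norm :: "'a :: real_normed_field ^ 'l ^ 'm \<Rightarrow> real" where
  "spectral_norm B = onorm (\<lambda>x. B *v x)"

definition norm_2inf :: "'a :: real_normed_field ^ 'l ^ 'm \<Rightarrow> real" where
  "norm_2inf B = Max (range (\<lambda>i. norm (row i B)))"

definition sep ::
  "(complex ^ 'l ^ 'm \<Rightarrow> real) \<Rightarrow> complex ^ 'l ^ 'l \<Rightarrow> complex ^ 'm ^ 'm \<Rightarrow> real" where
  "sep nrm B C = Inf {nrm (Z ** B - C ** Z) | Z. nrm Z = 1}"

definition sep_ran ::
  "(complex ^ 'l ^ 'm \<Rightarrow> real) \<Rightarrow> complex ^ 'k ^ 'm \<Rightarrow>
   complex ^ 'l ^ 'l \<Rightarrow> complex ^ 'm ^ 'm \<Rightarrow> real" where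
  "sep_ran nrm W B C =
     Inf {nrm (Z ** B - C ** Z) | Z. (\<forall>j. column j Z \<in> range (\<lambda>x. W *v x)) \<and> nrm Z = 1}"

definition positive_definite :: "complex ^ 'k ^ 'k \<Rightarrow> bool" where
  "positive_definite S \<longleftrightarrow>
     conj_transpose S = S \<and> (\<forall>x. x \<noteq> 0 \<longrightarrow> 0 < Re (\<Sum>i\<in>UNIV. cnj (x $ i) * (S *v x) $ i))"

text \<open>The principal power \<open>M\<^sup>-\<^sup>1\<^sup>/\<^sup>2\<close>; meaningful only for positive definite \<open>M\<close>.\<close>

definition inv_sqrt_matrix :: "complex ^ 'k ^ 'k \<Rightarrow> complex ^ 'k ^ 'k" where
  "inv_sqrt_matrix M = (THE S. positive_definite S \<and> S ** S = matrix_inv M)"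

definition invariant_subspace :: "complex ^ 'n ^ 'n \<Rightarrow> (complex ^ 'n) set \<Rightarrow> bool" where
  "invariant_subspace M V \<longleftrightarrow> vec.subspace V \<and> (\<forall>x\<in>V. M *v x \<in> V)"

end

theory Submission
  imports Defs
begin

text \<open>
  The range of \<open>U1 + U2 Y\<close> is invariant under \<open>A + E\<close> once \<open>Y\<close> solves the Riccati equation
  \<open>Y T11 - T22 Y = E21 + E22 Y - Y E11 - Y (T12 + E12) Y\<close>, where \<open>Eij = Ui* E Uj\<close>. As
  \<open>sep2 > 0\<close>, the Sylvester operator on the left is invertible, and Brouwer's theorem on the ball
  \<open>spectral_norm Y \<le> 2 spectral_norm E21 / sep2\<close> gives a solution. Multiplying the equation by
  \<open>U2\<close> turns it into one for \<open>Z = U2 Y\<close>, whose columns lie in the range of \<open>U2\<close>, so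
  \<open>sep_ran\<close> bounds the rows of \<open>Z\<close>. With \<open>S = (I + Y* Y)\<^sup>-\<^sup>1\<^sup>/\<^sup>2\<close> we have
  \<open>V1 - U1 = U1 (S - I) + Z S\<close>, so that already \<open>Q = I\<close> satisfies the claimed bound, and a
  minimizer exists because the orthogonal group is compact.
\<close>

section \<open>Matrix arithmetic, the Hermitian product and the conjugate transpose\<close>

lemma matrix_diff_ldistrib: "A ** (B - C) = A ** B - A ** C" for A :: "'a::comm_ring_1^'n^'m"
  by (simp add: matrix_matrix_mult_def vec_eq_iff algebra_simps sum_subtractf)

lemma matrix_diff_rdistrib: "(B - C) ** A = B ** A - C ** A" for A :: "'a::comm_ring_1^'n^'m"
  by (simp add: matrix_matrix_mult_def vec_eq_iff algebra_simps sum_subtractf)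

lemma matrix_add_rdistrib: "(B + C) ** A = B ** A + C ** A" for A :: "'a::comm_ring_1^'n^'m"
  by (simp add: matrix_matrix_mult_def vec_eq_iff algebra_simps sum.distrib)

lemma matrix_minus_left: "(- A) ** B = - (A ** B)" for A :: "'a::comm_ring_1^'n^'m"
  by (simp add: matrix_matrix_mult_def vec_eq_iff sum_negf)

lemma matrix_minus_right: "A ** (- B) = - (A ** B)" for A :: "'a::comm_ring_1^'n^'m"
  by (simp add: matrix_matrix_mult_def vec_eq_iff sum_negf)

lemmas matrix_ring = matrix_add_ldistrib matrix_add_rdistrib matrix_diff_ldistrib
  matrix_diff_rdistrib matrix_minus_left matrix_minus_right

lemma continuous_on_matrix_mult:
  fixes f :: "'x::topological_space \<Rightarrow> 'a::{real_normed_field}^'n^'m"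
  assumes "continuous_on S f" "continuous_on S g"
  shows "continuous_on S (\<lambda>x. f x ** g x)"
  unfolding matrix_matrix_mult_def using assms by (intro continuous_intros)

text \<open>The Hermitian product, conjugate linear in the first argument. The library's
  \<open>inner\<close> on \<open>complex^'n\<close> is only its real part, while adjoints of complex
  matrices call for the full complex value.\<close>

definition cdot :: "complex^'n \<Rightarrow> complex^'n \<Rightarrow> complex" where
  "cdot x y = (\<Sum>i\<in>UNIV. cnj (x $ i) * y $ i)"

lemma cdot_self: "cdot x x = of_real ((norm x)\<^sup>2)"
proof -
  have "(norm x)\<^sup>2 = (\<Sum>i\<in>UNIV. (norm (x $ i))\<^sup>2)"
    by (simp add: norm_vec_def L2_set_def sum_nonneg)
  then show ?thesis
    by (simp add: cdot_def complex_norm_square mult.commute del: of_real_power)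
qed

lemma norm_cdot_le: "norm (cdot x y) \<le> norm x * norm y"
proof -
  have "norm (cdot x y) \<le> (\<Sum>i\<in>UNIV. norm (x $ i) * norm (y $ i))"
    unfolding cdot_def by (rule order_trans[OF norm_sum]) (simp add: norm_mult)
  also have "\<dots> \<le> norm x * norm y"
    using L2_set_mult_ineq[of "\<lambda>i. norm (x $ i)" "\<lambda>i. norm (y $ i)" UNIV]
    by (simp add: norm_vec_def)
  finally show ?thesis .
qed

lemma cdot_diff_right: "cdot x (y - z) = cdot x y - cdot x z"
  by (simp add: cdot_def algebra_simps sum_subtractf)

lemma cdot_adjoint: "cdot x (B *v y) = cdot (conj_transpose B *v x) y"
  unfolding cdot_def matrix_vector_mult_def conj_transpose_def
  by (simp add: sum_distrib_left sum_distrib_right cnj_sum, subst sum.swap) (simp add: mult_ac)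

lemma conj_transpose_conj_transpose [simp]: "conj_transpose (conj_transpose B) = B"
  by (simp add: conj_transpose_def vec_eq_iff)

lemma conj_transpose_mult: "conj_transpose (A ** B) = conj_transpose B ** conj_transpose A"
  by (simp add: conj_transpose_def vec_eq_iff matrix_matrix_mult_def mult.commute)

lemma conj_transpose_add: "conj_transpose (A + B) = conj_transpose A + conj_transpose B"
  by (simp add: conj_transpose_def vec_eq_iff)

lemma conj_transpose_diff: "conj_transpose (A - B) = conj_transpose A - conj_transpose B"
  by (simp add: conj_transpose_def vec_eq_iff)

lemma conj_transpose_scaleR: "conj_transpose (c *\<^sub>R A) = c *\<^sub>R conj_transpose A"
  by (simp add: conj_transpose_def vec_eq_iff complex_eq_iff)

lemma conj_transpose_mat_1 [simp]: "conj_transpose (mat 1) = mat 1"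
  by (auto simp: conj_transpose_def vec_eq_iff mat_def)

section \<open>The spectral norm\<close>

lemma spectral_norm_ge: "norm (B *v x) \<le> spectral_norm B * norm x" for B :: "complex^'l^'m"
  unfolding spectral_norm_def by (rule onorm) simp

lemma spectral_norm_ge_real: "norm (B *v x) \<le> spectral_norm B * norm x" for B :: "real^'l^'m"
  unfolding spectral_norm_def by (rule onorm) simp

lemma spectral_norm_leI:
  "(\<And>x. norm (B *v x) \<le> c * norm x) \<Longrightarrow> spectral_norm B \<le> c" for B :: "complex^'l^'m"
  unfolding spectral_norm_def by (rule onorm_le)

lemma spectral_norm_nonneg: "0 \<le> spectral_norm B" for B :: "complex^'l^'m"
  unfolding spectral_norm_def by (rule onorm_pos_le) simp

lemma spectral_norm_nonneg_real: "0 \<le> spectral_norm B" for B :: "real^'l^'m"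
  unfolding spectral_norm_def by (rule onorm_pos_le) simp

lemma spectral_norm_mult: "spectral_norm (A ** B) \<le> spectral_norm A * spectral_norm B"
  for A :: "complex^'l^'m"
proof (rule spectral_norm_leI)
  fix x
  have "norm (A ** B *v x) \<le> spectral_norm A * norm (B *v x)"
    using spectral_norm_ge[of A "B *v x"] by (simp add: matrix_vector_mul_assoc)
  also have "\<dots> \<le> spectral_norm A * (spectral_norm B * norm x)"
    by (intro mult_left_mono spectral_norm_ge spectral_norm_nonneg)
  finally show "norm (A ** B *v x) \<le> spectral_norm A * spectral_norm B * norm x" by (simp add: mult.assoc)
qed

lemma spectral_norm_add: "spectral_norm (A + B) \<le> spectral_norm A + spectral_norm B"
  for A :: "complex^'l^'m"
proof (rule spectral_norm_leI)
  fix x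
  have "norm ((A + B) *v x) \<le> norm (A *v x) + norm (B *v x)"
    by (simp add: matrix_vector_mult_add_rdistrib norm_triangle_ineq)
  also have "\<dots> \<le> (spectral_norm A + spectral_norm B) * norm x"
    using spectral_norm_ge[of A x] spectral_norm_ge[of B x] by (simp add: algebra_simps)
  finally show "norm ((A + B) *v x) \<le> (spectral_norm A + spectral_norm B) * norm x" .
qed

lemma spectral_norm_scaleR: "spectral_norm (c *\<^sub>R A) = \<bar>c\<bar> * spectral_norm A"
  for A :: "complex^'l^'m"
proof -
  have "(*v) (c *\<^sub>R A) = (\<lambda>x. c *\<^sub>R (A *v x))"
    by (rule ext) (simp add: matrix_vector_mult_def vec_eq_iff scaleR_sum_right)
  then show ?thesis
    unfolding spectral_norm_def by (simp add: onorm_scaleR)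
qed

lemma spectral_norm_minus: "spectral_norm (- A) = spectral_norm A" for A :: "complex^'l^'m"
  using spectral_norm_scaleR[of "-1" A] by simp

lemma spectral_norm_diff: "spectral_norm (A - B) \<le> spectral_norm A + spectral_norm B"
  for A :: "complex^'l^'m"
  using spectral_norm_add[of A "-B"] by (simp add: spectral_norm_minus)

lemma spectral_norm_0 [simp]: "spectral_norm (0 :: complex^'l^'m) = 0"
  by (simp add: spectral_norm_def onorm_zero)

lemma spectral_norm_mat_1 [simp]: "spectral_norm (mat 1 :: complex^'l^'l) = 1"
  by (simp add: spectral_norm_def onorm_id)

text \<open>For \<open>y = B* x\<close>, the squared norm of \<open>y\<close> is the product of
  \<open>x\<close> with \<open>B y\<close>, hence at most
  \<open>norm x * spectral_norm B * norm y\<close>; cancelling one factor \<open>norm y\<close>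
  gives the claim.\<close>

lemma spectral_norm_conj_transpose_le: "spectral_norm (conj_transpose B) \<le> spectral_norm B"
proof (rule spectral_norm_leI)
  fix x
  let ?y = "conj_transpose B *v x"
  have "(norm ?y)\<^sup>2 = norm (cdot ?y ?y)" by (simp add: cdot_self norm_power)
  also have "\<dots> = norm (cdot x (B *v ?y))" by (simp add: cdot_adjoint)
  also have "\<dots> \<le> norm x * (spectral_norm B * norm ?y)"
    by (rule order_trans[OF norm_cdot_le]) (intro mult_left_mono spectral_norm_ge norm_ge_zero)
  finally have "norm ?y * norm ?y \<le> (spectral_norm B * norm x) * norm ?y"
    by (simp add: power2_eq_square mult_ac)
  then show "norm ?y \<le> spectral_norm B * norm x"
    by (cases "norm ?y = 0") (simp_all add: spectral_norm_nonneg mult_le_cancel_right)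
qed

lemma spectral_norm_conj_transpose: "spectral_norm (conj_transpose B) = spectral_norm B"
  using spectral_norm_conj_transpose_le[of B] spectral_norm_conj_transpose_le[of "conj_transpose B"]
  by simp

lemma spectral_norm_isometry_le: "spectral_norm U \<le> 1" if "conj_transpose U ** U = mat 1"
proof (rule spectral_norm_leI)
  fix x
  have "cdot (U *v x) (U *v x) = cdot x x"
    by (metis that cdot_adjoint conj_transpose_conj_transpose matrix_vector_mul_assoc matrix_vector_mul_lid)
  then have "(norm (U *v x))\<^sup>2 = (norm x)\<^sup>2"
    unfolding cdot_self by (simp only: of_real_eq_iff)
  then show "norm (U *v x) \<le> 1 * norm x" by simp
qed

text \<open>An entry is a coordinate of the image of a unit vector. Definiteness of the spectral
  norm and its comparison with \<open>norm\<close> both rest on this.\<close>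

lemma norm_entry_le_spectral_norm: "norm (B $ i $ j) \<le> spectral_norm B" for B :: "complex^'l^'m"
proof -
  have "norm (B $ i $ j) = norm ((B *v axis j 1) $ i)"
    by (simp add: matrix_vector_mult_def axis_def if_distrib cong: if_cong)
  also have "\<dots> \<le> norm (B *v axis j 1)" by (rule Finite_Cartesian_Product.norm_nth_le)
  also have "\<dots> \<le> spectral_norm B" using spectral_norm_ge[of B "axis j 1"] by simp
  finally show ?thesis .
qed

lemma spectral_norm_eq_0_iff: "spectral_norm B = 0 \<longleftrightarrow> B = 0" for B :: "complex^'l^'m"
proof
  assume "spectral_norm B = 0"
  then have "norm (B $ i $ j) \<le> 0" for i j using norm_entry_le_spectral_norm[of B i j] by simp
  then show "B = 0" by (simp add: vec_eq_iff)
qed simp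

text \<open>A crude comparison with the Frobenius norm, which is \<open>norm\<close> on the matrix
  type; the constant is irrelevant because only boundedness of spectral balls is drawn from
  it.\<close>

lemma norm_matrix_le_spectral_norm:
  "norm B \<le> real CARD('m) * (real CARD('l) * spectral_norm B)" for B :: "complex^'l^'m"
proof -
  have row: "norm (B $ i) \<le> real CARD('l) * spectral_norm B" for i
  proof -
    have "norm (B $ i) \<le> (\<Sum>j\<in>UNIV. norm (B $ i $ j))"
      unfolding norm_vec_def[of "B $ i"] by (rule L2_set_le_sum) simp
    also have "\<dots> \<le> (\<Sum>j\<in>(UNIV::'l set). spectral_norm B)"
      by (intro sum_mono norm_entry_le_spectral_norm)
    finally show ?thesis by simp
  qed
  have "norm B \<le> (\<Sum>i\<in>UNIV. norm (B $ i))"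
    unfolding norm_vec_def[of B] by (rule L2_set_le_sum) simp
  also have "\<dots> \<le> (\<Sum>i\<in>(UNIV::'m set). real CARD('l) * spectral_norm B)"
    by (intro sum_mono row)
  finally show ?thesis by simp
qed

text \<open>Cauchy-Schwarz in each row, then summation over the rows. This makes
  \<open>spectral_norm\<close> Lipschitz with constant 1 for the Frobenius distance.\<close>

lemma spectral_norm_le_norm: "spectral_norm B \<le> norm B" for B :: "complex^'l^'m"
proof (rule spectral_norm_leI)
  fix x
  have entry: "norm ((B *v x) $ i) \<le> norm (B $ i) * norm x" for i
  proof -
    have "norm ((B *v x) $ i) \<le> (\<Sum>j\<in>UNIV. \<bar>norm (B $ i $ j)\<bar> * \<bar>norm (x $ j)\<bar>)"
      unfolding matrix_vector_mult_def by (simp add: sum_norm_le norm_mult)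
    also have "\<dots> \<le> norm (B $ i) * norm x"
      unfolding norm_vec_def by (rule L2_set_mult_ineq)
    finally show ?thesis .
  qed
  have "norm (B *v x) \<le> L2_set (\<lambda>i. norm x * norm (B $ i)) UNIV"
    unfolding norm_vec_def[of "B *v x"] by (rule L2_set_mono) (use entry in \<open>simp_all add: mult.commute\<close>)
  also have "\<dots> = norm x * norm B"
    unfolding norm_vec_def[of B] by (rule L2_set_right_distrib[symmetric]) simp
  finally show "norm (B *v x) \<le> norm B * norm x" by (simp add: mult.commute)
qed

text \<open>Together with convexity, this makes spectral balls admissible domains for Brouwer's
  theorem.\<close>

lemma compact_spectral_ball: "compact {B :: complex^'l^'m. spectral_norm B \<le> \<rho>}"
proof -
  have "\<bar>spectral_norm B - spectral_norm C\<bar> \<le> norm (B - C)" for B C :: "complex^'l^'m"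
    using spectral_norm_add[of "B - C" C] spectral_norm_add[of "C - B" B]
      spectral_norm_le_norm[of "B - C"] spectral_norm_le_norm[of "C - B"]
    by (simp add: norm_minus_commute)
  then have "1-lipschitz_on UNIV (spectral_norm :: complex^'l^'m \<Rightarrow> real)"
    by (intro lipschitz_onI) (simp_all add: dist_norm)
  then have "continuous_on UNIV (spectral_norm :: complex^'l^'m \<Rightarrow> real)"
    by (rule lipschitz_on_continuous_on)
  then have "closed {B :: complex^'l^'m. spectral_norm B \<le> \<rho>}"
    by (intro closed_Collect_le continuous_intros)
  moreover have "bounded {B :: complex^'l^'m. spectral_norm B \<le> \<rho>}"
    unfolding bounded_iff
    by (rule exI[of _ "real CARD('m) * (real CARD('l) * \<rho>)"])
      (auto intro!: order_trans[OF norm_matrix_le_spectral_norm] mult_left_mono)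
  ultimately show ?thesis by (simp add: compact_eq_bounded_closed)
qed

lemma convex_spectral_ball: "convex {B :: complex^'l^'m. spectral_norm B \<le> \<rho>}"
proof (rule convexI)
  fix B C :: "complex^'l^'m" and u v :: real
  assume *: "B \<in> {B. spectral_norm B \<le> \<rho>}" "C \<in> {B. spectral_norm B \<le> \<rho>}" "0 \<le> u" "0 \<le> v" "u + v = 1"
  have "spectral_norm (u *\<^sub>R B + v *\<^sub>R C) \<le> u * spectral_norm B + v * spectral_norm C"
    using * spectral_norm_add[of "u *\<^sub>R B" "v *\<^sub>R C"] by (simp add: spectral_norm_scaleR)
  also have "\<dots> \<le> u * \<rho> + v * \<rho>" using * by (intro add_mono mult_left_mono) auto
  also have "\<dots> = \<rho>" using * by (metis distrib_right mult_1)
  finally show "u *\<^sub>R B + v *\<^sub>R C \<in> {B. spectral_norm B \<le> \<rho>}" by simp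
qed

text \<open>A real matrix acts separately on the real and imaginary parts of a vector, whose squared
  norms add up. This transfers the hypothesis on the real \<open>E\<close> to the complex
  estimates.\<close>

lemma spectral_norm_map_of_real_le:
  "spectral_norm (map_matrix complex_of_real E) \<le> spectral_norm E" for E :: "real^'l^'m"
proof (rule spectral_norm_leI)
  fix z :: "complex^'l"
  define x y :: "real^'l" where "x = (\<chi> j. Re (z $ j))" and "y = (\<chi> j. Im (z $ j))"
  have split: "(norm w)\<^sup>2 = (norm (\<chi> j. Re (w $ j)))\<^sup>2 + (norm (\<chi> j. Im (w $ j)))\<^sup>2"
    for w :: "complex^'k"
    by (simp add: norm_vec_def L2_set_def sum_nonneg cmod_power2 sum.distrib)
  let ?w = "map_matrix complex_of_real E *v z"
  have "(norm ?w)\<^sup>2 = (norm (E *v x))\<^sup>2 + (norm (E *v y))\<^sup>2"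
    unfolding split[of ?w] by (simp add: matrix_vector_mult_def x_def y_def)
  also have "\<dots> \<le> (spectral_norm E * norm x)\<^sup>2 + (spectral_norm E * norm y)\<^sup>2"
    by (intro add_mono power_mono spectral_norm_ge_real) auto
  also have "\<dots> = (spectral_norm E * norm z)\<^sup>2"
    unfolding power_mult_distrib split[of z] by (simp add: x_def y_def algebra_simps)
  finally show "norm ?w \<le> spectral_norm E * norm z"
    by (rule power2_le_imp_le) (simp add: spectral_norm_nonneg_real)
qed

section \<open>The maximum row norm\<close>

lemma norm_row_le_norm_2inf: "norm (row i B) \<le> norm_2inf B"
  unfolding norm_2inf_def by (intro Max_ge) auto

lemma norm_2inf_leI: "(\<And>i. norm (row i B) \<le> c) \<Longrightarrow> norm_2inf B \<le> c"
  unfolding norm_2inf_def by (subst Max_le_iff) auto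

lemma norm_2inf_nonneg: "0 \<le> norm_2inf B"
  using norm_row_le_norm_2inf[of undefined B] norm_ge_zero order_trans by blast

lemma norm_2inf_scaleR: "norm_2inf (c *\<^sub>R A) = \<bar>c\<bar> * norm_2inf A" for A :: "complex^'l^'m"
proof -
  have "norm (row i (c *\<^sub>R A)) = \<bar>c\<bar> * norm (row i A)" for i
    by (metis norm_scaleR row_def vec_lambda_eta vector_scaleR_component)
  moreover have "mono ((*) \<bar>c\<bar>)" by (simp add: mono_def mult_left_mono)
  ultimately show ?thesis
    unfolding norm_2inf_def by (subst mono_Max_commute) (auto simp: image_comp o_def)
qed

lemma norm_2inf_add: "norm_2inf (A + B) \<le> norm_2inf A + norm_2inf B" for A :: "complex^'l^'m"
proof (rule norm_2inf_leI)
  fix i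
  have "norm (row i (A + B)) \<le> norm (row i A) + norm (row i B)"
    by (metis norm_triangle_ineq row_def vec_lambda_eta vector_add_component)
  then show "norm (row i (A + B)) \<le> norm_2inf A + norm_2inf B"
    using norm_row_le_norm_2inf[of i A] norm_row_le_norm_2inf[of i B] by linarith
qed

lemma norm_2inf_minus: "norm_2inf (- A) = norm_2inf A" for A :: "complex^'l^'m"
  using norm_2inf_scaleR[of "-1" A] by simp

lemma norm_2inf_diff: "norm_2inf (A - B) \<le> norm_2inf A + norm_2inf B" for A :: "complex^'l^'m"
  using norm_2inf_add[of A "-B"] by (simp add: norm_2inf_minus)

lemma norm_2inf_le_norm: "norm_2inf B \<le> norm B" for B :: "complex^'l^'m"
  by (rule norm_2inf_leI) (metis Finite_Cartesian_Product.norm_nth_le row_def vec_lambda_eta)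

lemma norm_2inf_eq_0_iff: "norm_2inf B = 0 \<longleftrightarrow> B = 0" for B :: "complex^'l^'m"
proof
  assume "norm_2inf B = 0"
  then have "row i B = 0" for i using norm_row_le_norm_2inf[of i B] by simp
  then show "B = 0" by (simp add: vec_eq_iff row_def)
next
  show "B = 0 \<Longrightarrow> norm_2inf B = 0"
    using norm_2inf_le_norm[of B] norm_2inf_nonneg[of B] by simp
qed

text \<open>Up to entrywise conjugation, a row of \<open>A ** B\<close> is
  \<open>conj_transpose B\<close> applied to the conjugated row of \<open>A\<close>. Only the right
  factor is measured spectrally, so row information about the left factor survives.\<close>

lemma norm_2inf_mult: "norm_2inf (A ** B) \<le> norm_2inf A * spectral_norm B" for A :: "complex^'l^'m"
proof (rule norm_2inf_leI)
  fix i
  define a where "a = (\<chi> j. cnj (A $ i $ j))"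
  have cnj_norm: "norm (\<chi> j. cnj (v $ j)) = norm v" for v :: "complex^'k"
    by (simp add: norm_vec_def)
  have "norm (row i (A ** B)) = norm (conj_transpose B *v a)"
    by (subst cnj_norm[symmetric])
      (simp add: row_def a_def conj_transpose_def matrix_vector_mult_def matrix_matrix_mult_def mult.commute)
  also have "\<dots> \<le> spectral_norm B * norm a"
    using spectral_norm_ge[of "conj_transpose B" a] by (simp add: spectral_norm_conj_transpose)
  also have "norm a = norm (row i A)" by (simp add: a_def cnj_norm row_def)
  also have "spectral_norm B * norm (row i A) \<le> spectral_norm B * norm_2inf A"
    by (intro mult_left_mono norm_row_le_norm_2inf spectral_norm_nonneg)
  finally show "norm (row i (A ** B)) \<le> norm_2inf A * spectral_norm B" by (simp add: mult.commute)
qed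

text \<open>The triangle inequality and \<open>norm_2inf_le_norm\<close> give Lipschitz constant 1.
  The error is then continuous in \<open>Q\<close> and attains its minimum.\<close>

lemma continuous_on_norm_2inf: "continuous_on UNIV (norm_2inf :: complex^'l^'m \<Rightarrow> real)"
proof -
  have "\<bar>norm_2inf B - norm_2inf C\<bar> \<le> norm (B - C)" for B C :: "complex^'l^'m"
    using norm_2inf_add[of "B - C" C] norm_2inf_add[of "C - B" B]
      norm_2inf_le_norm[of "B - C"] norm_2inf_le_norm[of "C - B"]
    by (simp add: norm_minus_commute)
  then have "1-lipschitz_on UNIV (norm_2inf :: complex^'l^'m \<Rightarrow> real)"
    by (intro lipschitz_onI) (simp_all add: dist_norm)
  then show ?thesis by (rule lipschitz_on_continuous_on)
qed

section \<open>Lower bounds from the separation, and the Riccati equation\<close>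

lemma sep_spectral_norm_le:
  "sep spectral_norm B C * spectral_norm Z \<le> spectral_norm (Z ** B - C ** Z)"
proof (cases "Z = 0")
  case False
  \<comment> \<open>The infimum ranges over unit matrices only; since \<open>Z ** B - C ** Z\<close>
    is homogeneous in \<open>Z\<close>, rescaling by \<open>c\<close> covers every nonzero
    \<open>Z\<close>.\<close>
  define c where "c = 1 / spectral_norm Z"
  have pos: "0 < spectral_norm Z"
    using False spectral_norm_nonneg[of Z] spectral_norm_eq_0_iff[of Z] by linarith
  then have c: "0 < c" "spectral_norm (c *\<^sub>R Z) = 1" by (auto simp: c_def spectral_norm_scaleR)
  have eq: "(c *\<^sub>R Z) ** B - C ** (c *\<^sub>R Z) = c *\<^sub>R (Z ** B - C ** Z)"
    by (simp add: scaleR_diff_right scalar_matrix_assoc matrix_scalar_ac)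
  have "sep spectral_norm B C \<le> spectral_norm ((c *\<^sub>R Z) ** B - C ** (c *\<^sub>R Z))"
    unfolding sep_def
  proof (rule cInf_lower)
    show "bdd_below {spectral_norm (Z ** B - C ** Z) | Z. spectral_norm Z = 1}"
      by (rule bdd_belowI[of _ 0]) (auto intro: spectral_norm_nonneg)
  qed (use c in blast)
  also have "\<dots> = spectral_norm (Z ** B - C ** Z) / spectral_norm Z"
    using c by (simp add: eq spectral_norm_scaleR) (simp add: c_def)
  finally show ?thesis using pos by (simp add: field_simps)
qed simp

text \<open>The same rescaling argument as for \<open>sep\<close>. The form \<open>W ** Y\<close>
  makes the range condition on the columns automatic.\<close>

lemma sep_ran_norm_2inf_le:
  "sep_ran norm_2inf W B C * norm_2inf (W ** Y) \<le> norm_2inf ((W ** Y) ** B - C ** (W ** Y))"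
proof (cases "W ** Y = 0")
  case False
  define Z where "Z = W ** Y"
  define c where "c = 1 / norm_2inf Z"
  have pos: "0 < norm_2inf Z"
    using False norm_2inf_nonneg[of Z] norm_2inf_eq_0_iff[of Z] by (simp add: Z_def)
  then have c: "0 < c" "norm_2inf (c *\<^sub>R Z) = 1" by (auto simp: c_def norm_2inf_scaleR)
  have eq: "(c *\<^sub>R Z) ** B - C ** (c *\<^sub>R Z) = c *\<^sub>R (Z ** B - C ** Z)"
    by (simp add: scaleR_diff_right scalar_matrix_assoc matrix_scalar_ac)
  have col: "column j (c *\<^sub>R Z) = W *v column j (c *\<^sub>R Y)" for j
    by (simp add: Z_def column_def matrix_vector_mult_def matrix_matrix_mult_def vec_eq_iff scaleR_sum_right)
  have "sep_ran norm_2inf W B C \<le> norm_2inf ((c *\<^sub>R Z) ** B - C ** (c *\<^sub>R Z))"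
    unfolding sep_ran_def
  proof (rule cInf_lower)
    show "bdd_below {norm_2inf (Z ** B - C ** Z) | Z.
        (\<forall>j. column j Z \<in> range (\<lambda>x. W *v x)) \<and> norm_2inf Z = 1}"
      by (rule bdd_belowI[of _ 0]) (auto intro: norm_2inf_nonneg)
  qed (use c col in blast)
  also have "\<dots> = norm_2inf (Z ** B - C ** Z) / norm_2inf Z"
    using c by (simp add: eq norm_2inf_scaleR) (simp add: c_def)
  finally show ?thesis using pos by (simp add: field_simps Z_def)
qed (simp add: norm_2inf_eq_0_iff[THEN iffD2])

text \<open>Since \<open>s > 0\<close>, the Sylvester operator \<open>L\<close> is injective, hence
  bijective in finite dimension, with inverse of norm at most \<open>1 / s\<close>. A solution is a
  fixed point of the inverse composed with the right-hand side \<open>N\<close>. The bound on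
  \<open>H\<close> is twice the others because \<open>H\<close> will be
  \<open>T12 + E12\<close>.\<close>

lemma riccati_solution_exists:
  fixes T11 :: "complex^'r^'r" and T22 :: "complex^'s^'s"
    and G :: "complex^'r^'s" and H :: "complex^'s^'r"
  assumes s: "s = sep spectral_norm T11 T22" "0 < s"
    and small: "spectral_norm F11 \<le> s / 10" "spectral_norm F22 \<le> s / 10"
      "spectral_norm G \<le> s / 10" "spectral_norm H \<le> s / 5"
  obtains Y where "Y ** T11 - T22 ** Y = G + F22 ** Y - Y ** F11 - Y ** H ** Y"
    and "spectral_norm Y \<le> 2 * spectral_norm G / s"
proof -
  define L where "L = (\<lambda>Y. Y ** T11 - T22 ** Y)"
  define \<rho> where "\<rho> = 2 * spectral_norm G / s"
  define N where "N = (\<lambda>Y. G + F22 ** Y - Y ** F11 - Y ** H ** Y)"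
  let ?B = "{Y :: complex^'r^'s. spectral_norm Y \<le> \<rho>}"
  \<comment> \<open>The radius is at most 1/5 because \<open>spectral_norm G \<le> s / 10\<close>;
    this absorbs one factor \<open>Y\<close> of the quadratic term.\<close>
  have \<rho>: "0 \<le> \<rho>" "\<rho> \<le> 1/5" "spectral_norm G = s * \<rho> / 2"
    using small s by (auto simp: \<rho>_def field_simps spectral_norm_nonneg)
  have lower: "s * spectral_norm Y \<le> spectral_norm (L Y)" for Y
    unfolding L_def s(1) by (rule sep_spectral_norm_le)
  have "linear L"
    unfolding L_def
    by (rule linearI) (simp_all add: matrix_ring scaleR_diff_right scalar_matrix_assoc matrix_scalar_ac)
  moreover have "Y = 0" if "L Y = 0" for Y
  proof -
    have "spectral_norm Y \<le> 0"
      using lower[of Y] that s(2) by (simp add: mult_le_0_iff)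
    then show ?thesis
      using spectral_norm_nonneg[of Y] spectral_norm_eq_0_iff[of Y] by linarith
  qed
  ultimately have "surj L"
    by (intro linear_injective_imp_surjective) (simp_all add: linear_injective_0)
  then obtain g where g: "linear g" "L \<circ> g = id"
    using linear_surjective_right_inverse[OF \<open>linear L\<close>] by blast
  have Lg: "L (g W) = W" for W using g(2) by (metis comp_apply id_apply)
  have cont: "continuous_on ?B (\<lambda>Y. g (N Y))"
  proof (rule continuous_on_compose2[of UNIV g])
    show "continuous_on UNIV g"
      using g(1) by (simp add: linear_continuous_on linear_conv_bounded_linear)
    show "continuous_on ?B N"
      unfolding N_def by (intro continuous_intros continuous_on_matrix_mult)
  qed simp
  have "spectral_norm (g (N Y)) \<le> \<rho>" if Y: "spectral_norm Y \<le> \<rho>" for Y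
  proof -
    have nn: "0 \<le> spectral_norm Y" by (rule spectral_norm_nonneg)
    have 1: "spectral_norm (F22 ** Y) \<le> s / 10 * \<rho>"
      by (rule order_trans[OF spectral_norm_mult])
        (use small Y s nn in \<open>intro mult_mono; simp add: spectral_norm_nonneg\<close>)
    have 2: "spectral_norm (Y ** F11) \<le> \<rho> * (s / 10)"
      by (rule order_trans[OF spectral_norm_mult])
        (use small Y \<rho> in \<open>intro mult_mono; simp add: spectral_norm_nonneg\<close>)
    have 3: "spectral_norm (Y ** H) \<le> (1/5) * (s / 5)"
      by (rule order_trans[OF spectral_norm_mult])
        (use small Y \<rho> in \<open>intro mult_mono; simp add: spectral_norm_nonneg\<close>)
    have 4: "spectral_norm (Y ** H ** Y) \<le> (1/5) * (s / 5) * \<rho>"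
      by (rule order_trans[OF spectral_norm_mult])
        (use 3 Y s in \<open>intro mult_mono; simp add: spectral_norm_nonneg\<close>)
    have "spectral_norm (N Y) \<le> spectral_norm G + spectral_norm (F22 ** Y)
        + spectral_norm (Y ** F11) + spectral_norm (Y ** H ** Y)"
      unfolding N_def
      using spectral_norm_diff[of "G + F22 ** Y - Y ** F11" "Y ** H ** Y"]
        spectral_norm_diff[of "G + F22 ** Y" "Y ** F11"] spectral_norm_add[of G "F22 ** Y"]
      by linarith
    \<comment> \<open>The four terms contribute 1/2, 1/10, 1/10 and 1/25 of
      \<open>s * \<rho>\<close>, in total 37/50.\<close>
    also have "\<dots> \<le> s * \<rho>"
    proof -
      have "spectral_norm (F22 ** Y) \<le> s * \<rho> / 10" "spectral_norm (Y ** F11) \<le> s * \<rho> / 10"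
        "spectral_norm (Y ** H ** Y) \<le> s * \<rho> / 25" "0 \<le> s * \<rho>"
        using 1 2 4 \<rho> s(2) by (simp_all add: mult.commute)
      then show ?thesis using \<rho>(3) by linarith
    qed
    finally have "s * spectral_norm (g (N Y)) \<le> s * \<rho>"
      using lower[of "g (N Y)"] by (simp add: Lg)
    then show ?thesis using s(2) by simp
  qed
  then have maps: "(\<lambda>Y. g (N Y)) \<in> ?B \<rightarrow> ?B" by simp
  have "0 \<in> ?B" using \<rho>(1) by simp
  then have nonempty: "?B \<noteq> {}" by blast
  obtain Y where Y: "Y \<in> ?B" "g (N Y) = Y"
    by (rule brouwer[OF compact_spectral_ball convex_spectral_ball nonempty cont maps])
  then have "L Y = N Y" using Lg[of "N Y"] by simp
  then show thesis using that Y(1) by (simp add: L_def N_def \<rho>_def)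
qed

section \<open>Positive definite square roots\<close>

lemma positive_definite_cdot:
  "positive_definite S \<longleftrightarrow> conj_transpose S = S \<and> (\<forall>x. x \<noteq> 0 \<longrightarrow> 0 < Re (cdot x (S *v x)))"
  by (simp add: positive_definite_def cdot_def)

text \<open>The diagonal entries of the product are the values of the quadratic form of
  \<open>S\<close> at the columns of \<open>D\<close>, so for positive definite \<open>S\<close> a
  vanishing trace forces \<open>D = 0\<close>.\<close>

lemma trace_conj_transpose_sandwich:
  fixes S :: "complex^'k^'k"
  shows "trace (conj_transpose D ** S ** D) = (\<Sum>j\<in>UNIV. cdot (column j D) (S *v column j D))"
  unfolding matrix_mul_assoc[symmetric]
  by (simp add: trace_def conj_transpose_def cdot_def
      matrix_matrix_mult_def matrix_vector_mult_def column_def)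

text \<open>With \<open>D = S - R\<close>, the equation \<open>S\<^sup>2 = R\<^sup>2\<close> becomes \<open>S D + D R = 0\<close>, so the
  nonnegative numbers \<open>tr (D S D)\<close> and \<open>tr (D R D)\<close> add up to 0.\<close>

lemma positive_definite_sqrt_unique:
  fixes S R :: "complex^'k^'k"
  assumes S: "positive_definite S" and R: "positive_definite R" and eq: "S ** S = R ** R"
  shows "S = R"
proof -
  define D where "D = S - R"
  have herm: "conj_transpose D = D"
    using S R by (simp add: D_def positive_definite_cdot conj_transpose_diff)
  have "S ** D + D ** R = 0" using eq by (simp add: D_def matrix_ring)
  then have "D ** (S ** D + D ** R) = 0" by simp
  then have "trace (D ** (S ** D) + D ** (D ** R)) = trace (0 :: complex^'k^'k)"
    by (simp only: matrix_add_ldistrib)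
  then have "trace (D ** (S ** D)) + trace (D ** (D ** R)) = 0"
    by (simp add: trace_def sum.distrib)
  moreover have "trace (D ** (D ** R)) = trace (D ** R ** D)" by (rule trace_mul_sym)
  ultimately have "trace (conj_transpose D ** S ** D) + trace (conj_transpose D ** R ** D) = 0"
    by (simp add: herm matrix_mul_assoc)
  then have "Re (trace (conj_transpose D ** S ** D) + trace (conj_transpose D ** R ** D)) = 0"
    by simp
  then have sum0: "(\<Sum>j\<in>UNIV. Re (cdot (column j D) (S *v column j D))
      + Re (cdot (column j D) (R *v column j D))) = 0"
    unfolding trace_conj_transpose_sandwich by (simp add: sum.distrib)
  have nn: "0 \<le> Re (cdot x (P *v x))" if "positive_definite P" for P x
    using that by (cases "x = 0") (auto simp: positive_definite_cdot cdot_def less_imp_le)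
  have "column j D = 0" for j
  proof (rule ccontr)
    assume "column j D \<noteq> 0"
    then have "0 < Re (cdot (column j D) (S *v column j D))"
      using S by (simp add: positive_definite_cdot)
    moreover have "Re (cdot (column j D) (S *v column j D))
        + Re (cdot (column j D) (R *v column j D)) = 0"
      using sum_nonneg_0[OF _ _ sum0, of j] nn[OF S] nn[OF R] by simp
    ultimately show False using nn[OF R, of "column j D"] by linarith
  qed
  then have "D = 0" by (simp add: vec_eq_iff column_def)
  then show ?thesis by (simp add: D_def)
qed

text \<open>By Cauchy-Schwarz the quadratic form of \<open>X\<close> at a nonzero \<open>x\<close>
  stays strictly below the squared norm of \<open>x\<close>.\<close>

lemma positive_definite_mat_1_minus:
  assumes "conj_transpose X = X" "spectral_norm X < 1"
  shows "positive_definite (mat 1 - X)"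
  unfolding positive_definite_cdot
proof (intro conjI allI impI)
  fix x :: "complex^'a" assume "x \<noteq> 0"
  have "Re (cdot x (X *v x)) \<le> norm x * (spectral_norm X * norm x)"
    by (rule order_trans[OF complex_Re_le_cmod order_trans[OF norm_cdot_le]])
      (intro mult_left_mono spectral_norm_ge norm_ge_zero)
  also have "\<dots> < norm x * (1 * norm x)"
    using \<open>x \<noteq> 0\<close> assms(2) by (intro mult_strict_left_mono mult_strict_right_mono) simp_all
  finally show "0 < Re (cdot x ((mat 1 - X) *v x))"
    by (simp add: matrix_vector_mult_diff_rdistrib cdot_diff_right cdot_self power2_eq_square)
qed (use assms in \<open>simp add: conj_transpose_diff\<close>)

text \<open>Writing \<open>N = I - H\<close> and \<open>S = I - X\<close>, the equation \<open>S\<^sup>2 = N\<close> reads \<open>X = (H + X\<^sup>2) / 2\<close>,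
  whose right-hand side preserves the Hermitian matrices of norm at most that of \<open>H\<close>.\<close>

lemma positive_definite_sqrt_exists:
  fixes H :: "complex^'k^'k"
  assumes herm: "conj_transpose H = H" and small: "spectral_norm H < 1"
  obtains S where "positive_definite S" "S ** S = mat 1 - H" "spectral_norm (S - mat 1) \<le> spectral_norm H"
proof -
  define h where "h = spectral_norm H"
  let ?B = "{X :: complex^'k^'k. conj_transpose X = X} \<inter> {X. spectral_norm X \<le> h}"
  define F where "F = (\<lambda>X. (1/2) *\<^sub>R (H + X ** X))"
  have h: "0 \<le> h" "h < 1" using small by (simp_all add: h_def spectral_norm_nonneg)
  have "continuous_on UNIV (conj_transpose :: complex^'k^'k \<Rightarrow> _)"
    unfolding conj_transpose_def by (intro continuous_intros)
  then have "closed {X :: complex^'k^'k. conj_transpose X = X}"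
    by (intro closed_Collect_eq continuous_intros)
  then have compact: "compact ?B" by (intro closed_Int_compact compact_spectral_ball)
  have convex: "convex ?B"
    by (intro convex_Int convex_spectral_ball)
      (simp add: convex_def conj_transpose_add conj_transpose_scaleR)
  have "0 \<in> ?B" using h by (simp add: conj_transpose_def vec_eq_iff)
  then have nonempty: "?B \<noteq> {}" by blast
  have cont: "continuous_on ?B F"
    unfolding F_def by (intro continuous_intros continuous_on_matrix_mult)
  have "F X \<in> ?B" if X: "X \<in> ?B" for X
  proof -
    \<comment> \<open>As \<open>h < 1\<close>, the square of \<open>X\<close> has norm at most
      \<open>h * h \<le> h\<close>; the factor 1/2 in \<open>F\<close> then brings the sum of two
      such terms back to \<open>h\<close>.\<close>
    have "spectral_norm (H + X ** X) \<le> h + h * 1"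
    proof (rule order_trans[OF spectral_norm_add add_mono])
      have "spectral_norm (X ** X) \<le> spectral_norm X * spectral_norm X" by (rule spectral_norm_mult)
      also have "\<dots> \<le> h * 1" using X h by (intro mult_mono) (simp_all add: spectral_norm_nonneg)
      finally show "spectral_norm (X ** X) \<le> h * 1" .
    qed (simp add: h_def)
    then show ?thesis
      using X herm by (simp add: F_def spectral_norm_scaleR conj_transpose_scaleR
          conj_transpose_add conj_transpose_mult)
  qed
  then have maps: "F \<in> ?B \<rightarrow> ?B" by blast
  obtain X where X: "X \<in> ?B" "F X = X"
    by (rule brouwer[OF compact convex nonempty cont maps])
  have "2 *\<^sub>R F X = H + X ** X" by (simp add: F_def)
  then have X2: "X + X = H + X ** X" by (simp add: X(2) scaleR_2)
  show thesis
  proof (rule that)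
    show "positive_definite (mat 1 - X)"
      using X(1) h by (intro positive_definite_mat_1_minus) auto
    have "(mat 1 - X) ** (mat 1 - X) = mat 1 - (X + X) + X ** X"
      by (simp add: matrix_ring)
    then show "(mat 1 - X) ** (mat 1 - X) = mat 1 - H" by (simp add: X2)
    show "spectral_norm (mat 1 - X - mat 1) \<le> spectral_norm H"
      using X(1) by (simp add: spectral_norm_minus h_def)
  qed
qed

text \<open>The inverse of \<open>I + K\<close> is written as \<open>I - H\<close> with
  \<open>H\<close> small. The existence lemma yields a positive definite root near the identity, and
  uniqueness identifies it with the described \<open>inv_sqrt_matrix\<close>.\<close>

lemma inv_sqrt_matrix_near_identity:
  fixes K :: "complex^'k^'k"
  assumes herm: "conj_transpose K = K" and small: "spectral_norm K \<le> 1/4"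
  defines "S \<equiv> inv_sqrt_matrix (mat 1 + K)"
  shows "S ** S ** (mat 1 + K) = mat 1" "spectral_norm (S - mat 1) \<le> 2 * spectral_norm K"
proof -
  define M where "M = mat 1 + K"
  have "x = 0" if "M *v x = 0" for x
  proof -
    have "x = - (K *v x)"
      using that by (simp add: M_def matrix_vector_mult_add_rdistrib eq_neg_iff_add_eq_0)
    then have "norm x \<le> spectral_norm K * norm x" by (metis norm_minus_cancel spectral_norm_ge)
    also have "\<dots> \<le> 1/4 * norm x" using small by (intro mult_right_mono) auto
    finally show ?thesis by simp
  qed
  then have "invertible M"
    by (simp add: invertible_left_inverse matrix_left_invertible_ker)
  then have "M ** matrix_inv M = mat 1 \<and> matrix_inv M ** M = mat 1"
    unfolding invertible_def matrix_inv_def by (rule someI_ex)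
  then have inv: "M ** matrix_inv M = mat 1" "matrix_inv M ** M = mat 1" by simp_all
  define N where "N = matrix_inv M"
  define H where "H = mat 1 - N"
  have hermM: "conj_transpose M = M" by (simp add: M_def conj_transpose_add herm)
  \<comment> \<open>Taking adjoints in \<open>M ** N = mat 1\<close> with \<open>M\<close> Hermitian
    gives a left inverse of \<open>M\<close>, which must coincide with \<open>N\<close>.\<close>
  have "conj_transpose N ** M = mat 1"
    using inv(1) by (metis N_def conj_transpose_mat_1 conj_transpose_mult hermM)
  then have "conj_transpose N = N"
    using inv(1) by (metis N_def matrix_mul_assoc matrix_mul_lid matrix_mul_rid)
  then have hermH: "conj_transpose H = H" by (simp add: H_def conj_transpose_diff)
  have "N + K ** N = mat 1"
    using inv(1) unfolding N_def[symmetric] by (simp add: M_def matrix_add_rdistrib)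
  \<comment> \<open>The implicit equation bounds \<open>H\<close> by a geometric series argument:
    the norm of \<open>H\<close> is at most 4/3 that of \<open>K\<close>, hence at most 1/3.\<close>
  then have "H = K - K ** H" by (simp add: H_def matrix_ring algebra_simps)
  then have "spectral_norm H \<le> spectral_norm K + spectral_norm K * spectral_norm H"
    using spectral_norm_diff[of K "K ** H"] spectral_norm_mult[of K H] by simp
  also have "\<dots> \<le> spectral_norm K + 1/4 * spectral_norm H"
    using small by (intro add_mono mult_right_mono) (auto simp: spectral_norm_nonneg)
  finally have H: "spectral_norm H \<le> 4/3 * spectral_norm K" by simp
  then obtain R where R: "positive_definite R" "R ** R = mat 1 - H"
      "spectral_norm (R - mat 1) \<le> spectral_norm H"
    using positive_definite_sqrt_exists[OF hermH] small by force
  have "S = R"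
    unfolding S_def inv_sqrt_matrix_def M_def[symmetric] N_def[symmetric]
    using R by (intro the_equality) (auto intro: positive_definite_sqrt_unique simp: H_def)
  then show "S ** S ** (mat 1 + K) = mat 1" "spectral_norm (S - mat 1) \<le> 2 * spectral_norm K"
    using R H inv(2) spectral_norm_nonneg[of K] by (simp_all add: H_def N_def M_def)
qed

section \<open>The orthogonal group, block matrices and invariant subspaces\<close>

lemma compact_orthogonal_matrices: "compact {Q :: real^'r^'r. orthogonal_matrix Q}"
proof -
  have "continuous_on UNIV (\<lambda>Q :: real^'r^'r. transpose Q ** Q)"
    unfolding transpose_def by (intro continuous_on_matrix_mult continuous_intros)
  then have "closed {Q :: real^'r^'r. transpose Q ** Q = mat 1}"
    by (intro closed_Collect_eq continuous_intros)
  \<comment> \<open>The rows of an orthogonal matrix are unit vectors, which fixes its Frobenius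
    norm.\<close>
  moreover have "bounded {Q :: real^'r^'r. orthogonal_matrix Q}"
    unfolding bounded_iff
  proof (intro exI ballI)
    fix Q :: "real^'r^'r" assume "Q \<in> {Q. orthogonal_matrix Q}"
    then have "norm (row i Q) = 1" for i
      using orthogonal_matrix_orthonormal_rows by auto
    then have "norm (Q $ i) = 1" for i by (simp add: row_def)
    then show "norm Q \<le> L2_set (\<lambda>i::'r. 1) UNIV"
      by (simp add: norm_vec_def[of Q])
  qed
  ultimately show ?thesis by (simp add: compact_eq_bounded_closed orthogonal_matrix)
qed

lemma sum_UNIV_sum:
  "(\<Sum>k\<in>(UNIV :: ('r::finite + 's::finite) set). f k) = (\<Sum>a\<in>UNIV. f (Inl a)) + (\<Sum>b\<in>UNIV. f (Inr b))"
  by (simp add: UNIV_Plus_UNIV[symmetric] sum.Plus del: UNIV_Plus_UNIV)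

lemma block_columns_mult_block_rows:
  "block_columns B C ** block_rows F G = B ** F + C ** G"
  by (simp add: block_columns_def block_rows_def matrix_matrix_mult_def vec_eq_iff sum_UNIV_sum)

lemma mult_block_columns: "B ** block_columns C D = block_columns (B ** C) (B ** D)"
  by (auto simp: block_columns_def matrix_matrix_mult_def vec_eq_iff split: sum.split)

lemma block_columns_add: "block_columns B C + block_columns F G = block_columns (B + F) (C + G)"
  by (auto simp: block_columns_def vec_eq_iff split: sum.split)

lemma conj_transpose_block_columns:
  "conj_transpose (block_columns B C) = block_rows (conj_transpose B) (conj_transpose C)"
  by (auto simp: block_columns_def block_rows_def conj_transpose_def vec_eq_iff split: sum.split)

text \<open>The first four identities are the blocks of \<open>U* U = I\<close>; the last is
  \<open>U U* = I\<close>, a resolution of the identity into two orthogonal projections.\<close>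

lemma unitary_block_columnsD:
  assumes "unitary_matrix (block_columns U1 U2)"
  shows "conj_transpose U1 ** U1 = mat 1" "conj_transpose U1 ** U2 = 0"
    "conj_transpose U2 ** U1 = 0" "conj_transpose U2 ** U2 = mat 1"
    "U1 ** conj_transpose U1 + U2 ** conj_transpose U2 = mat 1"
proof -
  have "block_rows (conj_transpose U1) (conj_transpose U2) ** block_columns U1 U2 = mat 1"
    and 2: "block_columns U1 U2 ** block_rows (conj_transpose U1) (conj_transpose U2) = mat 1"
    using assms by (simp_all add: unitary_matrix_def conj_transpose_block_columns)
  then have entry: "(block_rows (conj_transpose U1) (conj_transpose U2) ** block_columns U1 U2) $ i $ j
      = mat 1 $ i $ j" for i j by simp
  show "conj_transpose U1 ** U1 = mat 1"
    using entry[of "Inl _" "Inl _"]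
    by (simp add: vec_eq_iff block_rows_def block_columns_def matrix_matrix_mult_def mat_def)
  show "conj_transpose U1 ** U2 = 0"
    using entry[of "Inl _" "Inr _"]
    by (simp add: vec_eq_iff block_rows_def block_columns_def matrix_matrix_mult_def mat_def)
  show "conj_transpose U2 ** U1 = 0"
    using entry[of "Inr _" "Inl _"]
    by (simp add: vec_eq_iff block_rows_def block_columns_def matrix_matrix_mult_def mat_def)
  show "conj_transpose U2 ** U2 = mat 1"
    using entry[of "Inr _" "Inr _"]
    by (simp add: vec_eq_iff block_rows_def block_columns_def matrix_matrix_mult_def mat_def)
  show "U1 ** conj_transpose U1 + U2 ** conj_transpose U2 = mat 1"
    using 2 by (simp add: block_columns_mult_block_rows)
qed

text \<open>The factorization is turned into the action of \<open>A\<close> on the two column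
  blocks, the form in which it enters the Riccati argument.\<close>

lemma schur_formD:
  assumes "schur_form A U1 U2 T11 T12 T22"
  shows "map_matrix complex_of_real A ** U1 = U1 ** T11"
    "map_matrix complex_of_real A ** U2 = U1 ** T12 + U2 ** T22"
proof -
  have U: "unitary_matrix (block_columns U1 U2)" using assms by (simp add: schur_form_def)
  note orth = unitary_block_columnsD[OF U]
  have A: "map_matrix complex_of_real A =
      U1 ** T11 ** conj_transpose U1 + (U1 ** T12 + U2 ** T22) ** conj_transpose U2"
    using assms
    by (simp add: schur_form_def conj_transpose_block_columns block_columns_mult_block_rows
        mult_block_columns block_columns_add)
  show "map_matrix complex_of_real A ** U1 = U1 ** T11"
    "map_matrix complex_of_real A ** U2 = U1 ** T12 + U2 ** T22"
    unfolding A by (simp_all add: matrix_add_rdistrib matrix_mul_assoc[symmetric] orth)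
qed

lemma invariant_subspace_range:
  assumes "M ** V = V ** B"
  shows "invariant_subspace M (range (\<lambda>x. V *v x))"
  unfolding invariant_subspace_def
proof (intro conjI ballI)
  show "vec.subspace (range (\<lambda>x. V *v x))"
    by (rule vec.subspace_image) simp_all
  fix x assume "x \<in> range (\<lambda>x. V *v x)"
  then obtain y where "x = V *v y" by auto
  then have "M *v x = V *v (B *v y)" by (simp add: matrix_vector_mul_assoc assms)
  then show "M *v x \<in> range (\<lambda>x. V *v x)" by simp
qed

section \<open>The perturbed invariant subspace and its row-wise distance to
  \<open>U1\<close>\<close>

theorem theorem5p1:
  fixes A E :: "real ^ 'n ^ 'n"
    and U1 :: "complex ^ ('r :: {finite, linorder}) ^ 'n"
    and U2 :: "complex ^ ('s :: {finite, linorder}) ^ 'n"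
    and T11 :: "complex ^ ('r :: {finite, linorder}) ^ ('r :: {finite, linorder})"
    and T12 :: "complex ^ ('s :: {finite, linorder}) ^ ('r :: {finite, linorder})"
    and T22 :: "complex ^ ('s :: {finite, linorder}) ^ ('s :: {finite, linorder})"
    and sep2 gap :: real
  assumes "schur_form A U1 U2 T11 T12 T22"
    and "sep2 = sep spectral_norm T11 T22"
    and "gap = min sep2 (sep_ran norm_2inf U2 T11 (U2 ** T22 ** conj_transpose U2))"
    and "gap > 0"
    and "spectral_norm E \<le> gap / 10"
    and "spectral_norm T12 \<le> gap / 10"
  shows "\<exists>Y :: complex ^ ('r :: {finite, linorder}) ^ ('s :: {finite, linorder}).
    let Ec = map_matrix complex_of_real E;
        P2 = U2 ** conj_transpose U2;
        E21 = conj_transpose U2 ** Ec ** U1;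
        V1 = (U1 + U2 ** Y) ** inv_sqrt_matrix (mat 1 + conj_transpose Y ** Y);
        err = (\<lambda>Q :: real ^ ('r :: {finite, linorder}) ^ ('r :: {finite, linorder}). norm_2inf (V1 ** map_matrix complex_of_real Q - U1))
    in invariant_subspace (map_matrix complex_of_real (A + E)) (range (\<lambda>x. V1 *v x)) \<and>
       (\<exists>Q. is_arg_min err orthogonal_matrix Q \<and>
            err Q \<le> 8 * norm_2inf U1 * (spectral_norm E / sep2)\<^sup>2
                   + 2 * (norm_2inf (P2 ** Ec ** U1) / gap)
                   + 4 * (norm_2inf (P2 ** Ec ** P2) * spectral_norm E21 / (gap * sep2)))"
proof -
  define Ac Ec where "Ac = map_matrix complex_of_real A" and "Ec = map_matrix complex_of_real E"
  define e where "e = spectral_norm E"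
  define V where "V = conj_transpose U1"
  define W where "W = conj_transpose U2"
  have AE: "map_matrix complex_of_real (A + E) = Ac + Ec"
    by (simp add: Ac_def Ec_def vec_eq_iff)
  note AU = schur_formD[OF assms(1), folded Ac_def]
  have "unitary_matrix (block_columns U1 U2)" using assms(1) by (simp add: schur_form_def)
  note orth = unitary_block_columnsD[OF this, folded V_def W_def]
  have gap: "0 < gap" "gap \<le> sep2" "gap \<le> sep_ran norm_2inf U2 T11 (U2 ** T22 ** W)"
    using assms by (simp_all add: W_def)
  have s: "0 < sep2" using gap by simp
  have U_le: "spectral_norm U1 \<le> 1" "spectral_norm U2 \<le> 1" "spectral_norm V \<le> 1" "spectral_norm W \<le> 1"
    using orth(1,4) spectral_norm_isometry_le
    by (auto simp: V_def W_def spectral_norm_conj_transpose)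
  have E_le: "spectral_norm Ec \<le> e" unfolding Ec_def e_def by (rule spectral_norm_map_of_real_le)
  have e: "0 \<le> e" "e \<le> gap / 10" using assms by (simp_all add: e_def spectral_norm_nonneg_real)
  have block_le: "spectral_norm (P ** Ec ** R) \<le> e"
    if "spectral_norm P \<le> 1" "spectral_norm R \<le> 1" for P :: "complex^'n^'a" and R :: "complex^'b^'n"
  proof -
    have "spectral_norm (P ** Ec ** R) \<le> spectral_norm P * spectral_norm Ec * spectral_norm R"
      by (rule order_trans[OF spectral_norm_mult])
        (intro mult_right_mono spectral_norm_mult spectral_norm_nonneg)
    also have "\<dots> \<le> 1 * e * 1"
      using that E_le e by (intro mult_mono) (simp_all add: spectral_norm_nonneg)
    finally show ?thesis by simp
  qed
  define E11 E12 E21 E22 where "E11 = V ** Ec ** U1" and "E12 = V ** Ec ** U2"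
    and "E21 = W ** Ec ** U1" and "E22 = W ** Ec ** U2"
  have Eij: "spectral_norm E11 \<le> e" "spectral_norm E12 \<le> e" "spectral_norm E21 \<le> e" "spectral_norm E22 \<le> e"
    unfolding E11_def E12_def E21_def E22_def by (intro block_le U_le)+
  define H where "H = T12 + E12"
  have H: "spectral_norm H \<le> gap / 5"
    using spectral_norm_add[of T12 E12] Eij(2) e assms(6) by (simp add: H_def)
  obtain Y where Y: "Y ** T11 - T22 ** Y = E21 + E22 ** Y - Y ** E11 - Y ** H ** Y"
    and Y_le: "spectral_norm Y \<le> 2 * spectral_norm E21 / sep2"
    by (rule riccati_solution_exists[of sep2 T11 T22 E11 E22 E21 H])
      (use assms(2) s Eij e gap H in simp_all)
  define y where "y = spectral_norm Y"
  have "y \<le> 2 * e / sep2"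
    unfolding y_def by (rule order_trans[OF Y_le]) (use Eij s in \<open>simp add: divide_right_mono\<close>)
  moreover have "2 * e / sep2 \<le> 1/5" using e gap s by (simp add: field_simps)
  ultimately have y: "0 \<le> y" "y \<le> 2 * (e / sep2)" "y \<le> 1/5"
    by (simp_all add: y_def spectral_norm_nonneg)
  \<comment> \<open>From here on \<open>y\<close> bounds the size of \<open>K\<close> quadratically,
    which is why the term in \<open>U1\<close> of the final bound is of second order.\<close>
  define K S where "K = conj_transpose Y ** Y" and "S = inv_sqrt_matrix (mat 1 + K)"
  have K_le: "spectral_norm K \<le> y\<^sup>2"
    using spectral_norm_mult[of "conj_transpose Y" Y]
    by (simp add: K_def y_def spectral_norm_conj_transpose power2_eq_square)
  have y2: "y\<^sup>2 \<le> 1/25" using power_mono[OF y(3,1), of 2] by (simp add: power2_eq_square)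
  have hermK: "conj_transpose K = K" by (simp add: K_def conj_transpose_mult)
  have K_quarter: "spectral_norm K \<le> 1/4" using K_le y2 by simp
  note S = inv_sqrt_matrix_near_identity[OF hermK K_quarter, folded S_def]
  \<comment> \<open>The constant 8 is 2 from the square root lemma times the square of the 2 in the
    bound on \<open>y\<close>.\<close>
  have S1: "spectral_norm (S - mat 1) \<le> 8 * (e / sep2)\<^sup>2"
    using S(2) K_le power_mono[OF y(2,1), of 2] unfolding power_mult_distrib by simp
  \<comment> \<open>Here \<open>1 + 2 * (1/25) = 27/25\<close>.\<close>
  have S_le: "spectral_norm S \<le> 27/25"
    using spectral_norm_add[of "S - mat 1" "mat 1"] S(2) K_le y2 by simp
  define X where "X = U1 + U2 ** Y"
  \<comment> \<open>\<open>B\<close> is \<open>V ** (Ac + Ec) ** X\<close>, the only possible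
    coefficient matrix in \<open>(Ac + Ec) ** X = X ** B\<close>, since
    \<open>V ** X = mat 1\<close>.\<close>
  define B where "B = T11 + E11 + H ** Y"
  \<comment> \<open>The resolution of the identity is inserted in front of
    \<open>Ec\<close>.\<close>
  have Ec_U: "Ec ** U1 = U1 ** E11 + U2 ** E21" "Ec ** U2 = U1 ** E12 + U2 ** E22"
    using arg_cong[OF orth(5), of "\<lambda>P. P ** (Ec ** U1)"] arg_cong[OF orth(5), of "\<lambda>P. P ** (Ec ** U2)"]
    by (simp_all add: E11_def E12_def E21_def E22_def matrix_add_rdistrib matrix_mul_assoc)
  \<comment> \<open>This is the Riccati equation rearranged: the \<open>U2\<close> component of
    \<open>(Ac + Ec) ** X\<close> equals that of \<open>X ** B\<close>.\<close>
  have YB: "Y ** B = E21 + T22 ** Y + E22 ** Y"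
    using Y by (simp add: B_def matrix_ring matrix_mul_assoc algebra_simps)
  have "(Ac + Ec) ** X = Ac ** U1 + Ac ** U2 ** Y + Ec ** U1 + Ec ** U2 ** Y"
    by (simp add: X_def matrix_ring matrix_mul_assoc add_ac)
  also have "\<dots> = U1 ** B + U2 ** (E21 + T22 ** Y + E22 ** Y)"
    unfolding AU Ec_U B_def H_def by (simp add: matrix_ring matrix_mul_assoc add_ac)
  also have "\<dots> = X ** B"
    unfolding YB[symmetric] by (simp add: X_def matrix_ring matrix_mul_assoc)
  finally have XB: "(Ac + Ec) ** X = X ** B" .
  have "(Ac + Ec) ** (X ** S) = X ** B ** S" by (simp add: XB matrix_mul_assoc)
  \<comment> \<open>Inserting the identity in this form exhibits \<open>X\<close> as
    \<open>X ** S\<close> times a matrix, so normalization preserves invariance.\<close>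
  also have "\<dots> = X ** (S ** S ** (mat 1 + K)) ** B ** S" unfolding S(1) by simp
  also have "\<dots> = (X ** S) ** (S ** (mat 1 + K) ** B ** S)" by (simp add: matrix_mul_assoc)
  finally have inv: "invariant_subspace (Ac + Ec) (range (\<lambda>x. (X ** S) *v x))"
    by (rule invariant_subspace_range)
  define Z where "Z = U2 ** Y"
  define P2 where "P2 = U2 ** W"
  have P2_Z: "P2 ** Z = Z" "W ** Z = Y"
    unfolding P2_def Z_def
    by (simp_all add: matrix_mul_assoc[symmetric]) (simp_all add: matrix_mul_assoc orth(4))
  \<comment> \<open>The Riccati equation is multiplied by \<open>U2\<close> from the left;
    \<open>W ** Z = Y\<close> and \<open>P2 ** Z = Z\<close> then express everything through
    \<open>Z\<close>.\<close>
  have "Z ** T11 - U2 ** T22 ** W ** Z = U2 ** (Y ** T11 - T22 ** Y)"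
    unfolding matrix_mul_assoc[symmetric] P2_Z by (simp add: Z_def matrix_ring matrix_mul_assoc)
  also have "\<dots> = P2 ** Ec ** U1 + P2 ** Ec ** P2 ** Z - Z ** E11 - Z ** (H ** Y)"
    unfolding Y unfolding matrix_mul_assoc[symmetric] P2_Z
    by (simp add: Z_def P2_def E21_def E22_def matrix_ring matrix_mul_assoc)
  finally have Z_eq: "Z ** T11 - U2 ** T22 ** W ** Z
      = P2 ** Ec ** U1 + P2 ** Ec ** P2 ** Z - Z ** E11 - Z ** (H ** Y)" .
  define a b z where "a = norm_2inf (P2 ** Ec ** U1)" and "b = norm_2inf (P2 ** Ec ** P2)"
    and "z = norm_2inf Z"
  have nn: "0 \<le> a" "0 \<le> b" "0 \<le> z" by (simp_all add: a_def b_def z_def norm_2inf_nonneg)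
  have Z_le: "spectral_norm Z \<le> 2 * spectral_norm E21 / sep2"
  proof -
    have "spectral_norm Z \<le> spectral_norm U2 * spectral_norm Y"
      unfolding Z_def by (rule spectral_norm_mult)
    also have "\<dots> \<le> 1 * spectral_norm Y" by (intro mult_right_mono U_le spectral_norm_nonneg)
    finally show ?thesis using Y_le by simp
  qed
  have 1: "norm_2inf (P2 ** Ec ** P2 ** Z) \<le> b * (2 * spectral_norm E21 / sep2)"
    unfolding b_def
    by (rule order_trans[OF norm_2inf_mult]) (intro mult_left_mono Z_le norm_2inf_nonneg)
  have 2: "norm_2inf (Z ** E11) \<le> z * (gap / 10)"
    unfolding z_def
    by (rule order_trans[OF norm_2inf_mult])
      (use Eij(1) e in \<open>intro mult_left_mono norm_2inf_nonneg; linarith\<close>)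
  \<comment> \<open>Grouping the quadratic term as \<open>Z ** (H ** Y)\<close> keeps
    \<open>Z\<close> as the left factor, so \<open>norm_2inf_mult\<close> returns a multiple of
    \<open>z\<close>.\<close>
  have "spectral_norm (H ** Y) \<le> gap / 5 * (1/5)"
    by (rule order_trans[OF spectral_norm_mult])
      (use H y gap in \<open>intro mult_mono; simp add: spectral_norm_nonneg y_def\<close>)
  then have 3: "norm_2inf (Z ** (H ** Y)) \<le> z * (gap / 25)"
    unfolding z_def
    by (intro order_trans[OF norm_2inf_mult] mult_left_mono norm_2inf_nonneg) simp
  define c where "c = a + b * (2 * spectral_norm E21 / sep2)"
  have "gap * z \<le> sep_ran norm_2inf U2 T11 (U2 ** T22 ** W) * z"
    using gap nn by (intro mult_right_mono) auto
  also have "\<dots> \<le> norm_2inf (Z ** T11 - U2 ** T22 ** W ** Z)"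
    unfolding z_def Z_def by (rule sep_ran_norm_2inf_le)
  also have "\<dots> \<le> a + norm_2inf (P2 ** Ec ** P2 ** Z) + norm_2inf (Z ** E11) + norm_2inf (Z ** (H ** Y))"
    unfolding Z_eq a_def
    using norm_2inf_diff[of "P2 ** Ec ** U1 + P2 ** Ec ** P2 ** Z - Z ** E11" "Z ** (H ** Y)"]
      norm_2inf_diff[of "P2 ** Ec ** U1 + P2 ** Ec ** P2 ** Z" "Z ** E11"]
      norm_2inf_add[of "P2 ** Ec ** U1" "P2 ** Ec ** P2 ** Z"] by linarith
  also have "\<dots> \<le> c + z * (gap / 10) + z * (gap / 25)" using 1 2 3 unfolding c_def by linarith
  \<comment> \<open>The terms in \<open>z\<close> are absorbed on the left:
    \<open>1 - 1/10 - 1/25 = 43/50\<close>.\<close>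
  finally have "gap * (z * (43/50)) \<le> c" by (simp add: algebra_simps)
  then have "z * (43/50) \<le> c / gap" using gap by (simp add: field_simps)
  moreover have "0 \<le> c" using nn s by (simp add: c_def spectral_norm_nonneg)
  then have "0 \<le> c / gap" using gap by simp
  \<comment> \<open>The factor 27/25 is the bound on \<open>S\<close>; the quotient of 27/25 by
    43/50 is 54/43, below 2.\<close>
  ultimately have z_le: "z * (27/25) \<le> 2 * (c / gap)" by linarith
  define err where
    "err = (\<lambda>Q :: ((real, 'r) vec, 'r) vec. norm_2inf (X ** S ** map_matrix complex_of_real Q - U1))"
  \<comment> \<open>The first summand is controlled by the distance of \<open>S\<close> from the
    identity, the second by the row norm of \<open>Z\<close>.\<close>
  have "X ** S - U1 = U1 ** (S - mat 1) + Z ** S"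
    by (simp add: X_def Z_def matrix_ring)
  then have "norm_2inf (X ** S - U1) \<le> norm_2inf (U1 ** (S - mat 1)) + norm_2inf (Z ** S)"
    using norm_2inf_add by metis
  also have "\<dots> \<le> norm_2inf U1 * (8 * (e / sep2)\<^sup>2) + z * (27/25)"
    unfolding z_def
    by (intro add_mono order_trans[OF norm_2inf_mult] mult_left_mono S1 S_le norm_2inf_nonneg)
  also have "\<dots> \<le> 8 * norm_2inf U1 * (e / sep2)\<^sup>2 + 2 * (c / gap)"
    using z_le by simp
  also have "2 * (c / gap) = 2 * (a / gap) + 4 * (b * spectral_norm E21 / (gap * sep2))"
    using gap s by (simp add: c_def field_simps)
  finally have bound: "norm_2inf (X ** S - U1) \<le> 8 * norm_2inf U1 * (e / sep2)\<^sup>2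
      + 2 * (a / gap) + 4 * (b * spectral_norm E21 / (gap * sep2))"
    by (simp add: add.assoc)
  have id: "map_matrix complex_of_real (mat 1 :: ((real, 'r) vec, 'r) vec) = mat 1"
    by (simp add: vec_eq_iff mat_def)
  have "continuous_on {Q. orthogonal_matrix Q} err"
    unfolding err_def map_matrix_def
    by (rule continuous_on_compose2[OF continuous_on_norm_2inf])
      (intro continuous_intros continuous_on_matrix_mult, simp)
  \<comment> \<open>The identity shows the feasible set nonempty and later serves as the competitor
    against which the minimizer is compared.\<close>
  moreover have "mat 1 \<in> {Q :: ((real, 'r) vec, 'r) vec. orthogonal_matrix Q}" by (simp add: orthogonal_matrix_id)
  ultimately obtain Q where Q: "orthogonal_matrix Q" "\<And>R. orthogonal_matrix R \<Longrightarrow> err Q \<le> err R"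
    using continuous_attains_inf[OF compact_orthogonal_matrices, of err] by blast
  have "is_arg_min err orthogonal_matrix Q"
    using Q by (auto simp: is_arg_min_def not_less)
  moreover have "err Q \<le> norm_2inf (X ** S - U1)"
    using Q(2)[OF orthogonal_matrix_id] by (simp add: err_def id)
  ultimately have "\<exists>Q. is_arg_min err orthogonal_matrix Q \<and> err Q \<le> 8 * norm_2inf U1 * (e / sep2)\<^sup>2
      + 2 * (a / gap) + 4 * (b * spectral_norm E21 / (gap * sep2))"
    using bound by (meson order_trans)
  then show ?thesis
    unfolding Let_def AE
    unfolding err_def e_def a_def b_def P2_def E21_def W_def Ec_def Ac_def
    using inv unfolding X_def S_def K_def Ac_def Ec_def by blast
qed

end
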